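(* Let $r_1,r_2\in\mathbb{Z}$ and let $(U_n)_{n\ge0}$ be a sequence of integers with $U_n=r_1U_{n-1}+r_2U_{n-2}$ for all $n\ge2$. Let $\alpha,\beta$ be the roots of $x^2-r_1x-r_2$, assume $\alpha\neq\beta$, let $\Delta=(\alpha-\beta)^2=r_1^2+4r_2$, and assume $\Delta$ is not the square of an integer. Let $l_1,l_2$ be the constants with $U_n=l_1\alpha^n+l_2\beta^n$ for all $n\ge0$. Then the following are equivalent: (1) $(U_n)_{n\ge1}$ almost satisfies the Dold condition; (2) $l_1=l_2$; (3) the sequence $(2r_2\operatorname{rad}(\Delta)U_n)_{n\ge1}$ satisfies the Dold condition.
   Context: A sequence of integers $(A_n)_{n\ge1}$ satisfies the Dold condition if $n\mid\sum_{d\mid n}\mu(d)A_{n/d}$ for every $n\in\mathbb{N}_+$ ($\mu$ the Möbius function). It almost satisfies the Dold condition if there is $c\in\mathbb{N}_+$ such that $(cA_n)_{n\ge1}$ satisfies the Dold condition. For a nonzero integer $m$, $\operatorname{rad}(m)$ denotes the product of the distinct primes dividing $m$. *)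

theory Defs
  imports
    Complex_Main
    "HOL-Computational_Algebra.Computational_Algebra"
begin

definition moebius_mu :: "nat \<Rightarrow> int" where
  "moebius_mu n = (if squarefree n then (-1) ^ card (prime_factors n) else 0)"

(* Sequences indexed from 1 are modelled as functions on nat; the value at 0 is never used,
   since n div d \<ge> 1 whenever d divides n > 0. *)
definition dold :: "(nat \<Rightarrow> int) \<Rightarrow> bool" where
  "dold A \<longleftrightarrow> (\<forall>n>0. int n dvd (\<Sum>d | d dvd n. moebius_mu d * A (n div d)))"

definition almost_dold :: "(nat \<Rightarrow> int) \<Rightarrow> bool" where
  "almost_dold A \<longleftrightarrow> (\<exists>c::nat. c > 0 \<and> dold (\<lambda>n. int c * A n))"

(* Elements of prime_factors m are normalized, hence positive, also for negative m. *)
definition rad :: "int \<Rightarrow> int" where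
  "rad m = \<Prod>(prime_factors m)"

lemma discriminant_eq_root_difference_square:
  fixes r1 r2 :: int and \<alpha> \<beta> :: complex
  assumes roots: "{x. poly [:- of_int r2, - of_int r1, 1:] x = 0} = {\<alpha>, \<beta>}"
    and "\<alpha> \<noteq> \<beta>"
  shows "(\<alpha> - \<beta>)\<^sup>2 = of_int (r1\<^sup>2 + 4 * r2)"
proof -
  have a: "\<alpha> * \<alpha> = of_int r1 * \<alpha> + of_int r2" and b: "\<beta> * \<beta> = of_int r1 * \<beta> + of_int r2"
    using roots by (auto simp: set_eq_iff algebra_simps)
  have "(\<alpha> - \<beta>) * (\<alpha> + \<beta>) = (\<alpha> - \<beta>) * of_int r1"
    using a b by (simp add: algebra_simps)
  hence s: "\<alpha> + \<beta> = of_int r1"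
    using \<open>\<alpha> \<noteq> \<beta>\<close> by simp
  have "(\<alpha> - \<beta>)\<^sup>2 = 2 * (\<alpha> * \<alpha>) + 2 * (\<beta> * \<beta>) - (\<alpha> + \<beta>)\<^sup>2"
    by (simp add: power2_eq_square algebra_simps)
  also have "\<dots> = 2 * of_int r1 * (\<alpha> + \<beta>) + 4 * of_int r2 - (\<alpha> + \<beta>)\<^sup>2"
    unfolding a b by (simp add: algebra_simps)
  also have "\<dots> = of_int (r1\<^sup>2 + 4 * r2)"
    unfolding s by (simp add: power2_eq_square)
  finally show ?thesis .
qed

end

theory Submission
  imports Defs "HOL-Number_Theory.Number_Theory"
begin

text \<open>
  Put $e = 2U_1 - r_1U_0 = (l_1 - l_2)(\alpha - \beta)$. For an odd prime $p$, the binomial theorem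
  and Euler's criterion give $2U_p \equiv U_0 r_1 + e\left(\frac{\Delta}{p}\right)$ mod $p$, whereas
  $2U_1 = U_0 r_1 + e$. So if $cU$ satisfies the Dold condition, then $p \mid 2ce$ for every $p$ with
  $\left(\frac{\Delta}{p}\right) = -1$. A non-square $\Delta$ has infinitely many such $p$, by
  quadratic reciprocity and the Chinese remainder theorem, hence $e = 0$ and $l_1 = l_2$.

  Conversely, if $l_1 = l_2$ then $2U_n = U_0(\alpha^n + \beta^n)$, and $\alpha^n + \beta^n$
  satisfies the Dold condition: writing $1 - r_1x - r_2x^2 = \prod_d (1 - x^d)^{b_d}$ with integers
  $b_d$ and taking logarithmic derivatives gives $\alpha^n + \beta^n = \sum_{d \mid n} d\,b_d$, whose
  Moebius transform is $n b_n$.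
\<close>

section \<open>Divisor sums and the Dold condition\<close>

lemma moebius_mu_1 [simp]: "moebius_mu (Suc 0) = 1"
  by (simp add: moebius_mu_def)

lemma moebius_mu_prime_mult:
  assumes "prime p" "\<not> p dvd d"
  shows "moebius_mu (p * d) = - moebius_mu d"
proof -
  have d0: "d \<noteq> 0" using assms by (metis dvd_0_right)
  have cop: "coprime p d" using assms by (simp add: prime_imp_coprime)
  have sf: "squarefree (p * d) \<longleftrightarrow> squarefree d"
    using squarefree_mult_coprime[OF cop squarefree_prime[OF assms(1)]] squarefree_multD(2) by blast
  have "prime_factors (p * d) = insert p (prime_factors d)"
    using assms d0 by (simp add: prime_factorization_times_prime)
  moreover have "p \<notin> prime_factors d" using assms by auto
  ultimately show ?thesis by (simp add: moebius_mu_def sf)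
qed

lemma moebius_mu_prime [simp]: "prime p \<Longrightarrow> moebius_mu p = -1"
  using moebius_mu_prime_mult[of p 1] by (auto dest: prime_gt_1_nat)

lemma moebius_mu_prime_mult_eq_0:
  assumes "prime p" "p dvd d"
  shows "moebius_mu (p * d) = 0"
proof -
  have "p\<^sup>2 dvd p * d" using assms by (simp add: power2_eq_square)
  hence "\<not> squarefree (p * d)" using assms by (auto simp: squarefree_def)
  thus ?thesis by (simp add: moebius_mu_def)
qed

text \<open>Divisors divisible by a fixed prime $p$ cancel against those that are not.\<close>

lemma sum_moebius_mu_divisors:
  fixes n :: nat
  assumes "n > 0"
  shows "(\<Sum>d | d dvd n. moebius_mu d) = (if n = 1 then 1 else 0)"
proof (cases "n = 1")
  case False
  then obtain p where p: "prime p" "p dvd n" using prime_factor_nat by blast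
  have fin: "finite {d. d dvd n}" using assms by simp
  let ?A = "{d. d dvd n \<and> \<not> p dvd d}" and ?B = "{d. d dvd n \<and> p dvd d}"
  have "(\<Sum>d | d dvd n. moebius_mu d) = sum moebius_mu ?A + sum moebius_mu ?B"
    using fin by (subst sum.union_disjoint [symmetric]) (auto intro: sum.cong)
  \<comment> \<open>A multiple of \<open>p\<close> outside the image has the form
    \<open>p * d\<close> with \<open>p dvd d\<close>, so its Moebius value is 0; only
    \<open>p\<close> times the elements of \<open>?A\<close> contribute.\<close>
  moreover have "sum moebius_mu ?B = sum moebius_mu ((*) p ` ?A)"
  proof (rule sum.mono_neutral_right)
    show "finite ?B" using fin by auto
    show "(*) p ` ?A \<subseteq> ?B"
      using p by (auto intro!: divides_mult prime_imp_coprime)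
    show "\<forall>i\<in>?B - (*) p ` ?A. moebius_mu i = 0"
    proof
      fix i assume i: "i \<in> ?B - (*) p ` ?A"
      then obtain d where d: "i = p * d" by (auto elim: dvdE)
      with i have "d dvd n" using dvd_mult_right by blast
      with i d have "p dvd d" by auto
      with p d show "moebius_mu i = 0" by (simp add: moebius_mu_prime_mult_eq_0)
    qed
  qed
  moreover have "sum moebius_mu ((*) p ` ?A) = - sum moebius_mu ?A"
    using p by (subst sum.reindex)
      (auto simp: inj_on_def moebius_mu_prime_mult sum_negf [symmetric] intro!: sum.cong)
  ultimately show ?thesis using False by simp
qed auto

text \<open>After swapping the two divisor sums, the coefficient of \<open>b e\<close> is the
  Moebius sum over the divisors of \<open>n div e\<close>, which vanishes unless
  \<open>e = n\<close>. The divisor-sum formula is assumed only at divisors of \<open>n\<close>, so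
  \<open>b\<close> may depend on \<open>n\<close>.\<close>

lemma moebius_inversion:
  fixes A b :: "nat \<Rightarrow> int"
  assumes "n > 0" and A: "\<And>m. m dvd n \<Longrightarrow> A m = (\<Sum>e | e dvd m. b e)"
  shows "(\<Sum>d | d dvd n. moebius_mu d * A (n div d)) = b n"
proof -
  let ?D = "{d. d dvd n}"
  have fin: "finite ?D" using assms by simp
  have "(\<Sum>d\<in>?D. moebius_mu d * A (n div d)) = (\<Sum>d\<in>?D. \<Sum>e | e \<in> ?D \<and> d * e dvd n. moebius_mu d * b e)"
  proof (rule sum.cong[OF refl])
    fix d assume d: "d \<in> ?D"
    then obtain k where k: "n = d * k" by auto
    have "d > 0" using d assms by (auto intro: Nat.gr0I)
    hence "{e. e dvd n div d} = {e. e \<in> ?D \<and> d * e dvd n}" using k by auto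
    moreover have "n div d dvd n" using d by auto
    ultimately show "moebius_mu d * A (n div d) = (\<Sum>e | e \<in> ?D \<and> d * e dvd n. moebius_mu d * b e)"
      by (simp add: A sum_distrib_left)
  qed
  also have "\<dots> = (\<Sum>e\<in>?D. \<Sum>d | d \<in> ?D \<and> d * e dvd n. moebius_mu d * b e)"
    by (rule sum.swap_restrict[OF fin fin])
  also have "\<dots> = (\<Sum>e\<in>?D. if e = n then b e else 0)"
  proof (rule sum.cong[OF refl])
    fix e assume e: "e \<in> ?D"
    then obtain k where k: "n = e * k" by auto
    have pos: "e > 0" "k > 0" using assms k by auto
    have "{d. d \<in> ?D \<and> d * e dvd n} = {d. d dvd k}"
      using pos k by (auto simp: mult.commute)
    hence "(\<Sum>d | d \<in> ?D \<and> d * e dvd n. moebius_mu d * b e) = (\<Sum>d | d dvd k. moebius_mu d) * b e"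
      by (simp add: sum_distrib_right)
    also have "\<dots> = (if e = n then b e else 0)"
      using pos k by (subst sum_moebius_mu_divisors) auto
    finally show "(\<Sum>d | d \<in> ?D \<and> d * e dvd n. moebius_mu d * b e) = (if e = n then b e else 0)" .
  qed
  also have "\<dots> = b n" using fin by (simp add: sum.delta)
  finally show ?thesis .
qed

lemma dold_mult:
  assumes "dold A"
  shows "dold (\<lambda>n. c * A n)"
  unfolding dold_def
proof (intro allI impI)
  fix n :: nat assume n: "n > 0"
  have "(\<Sum>d | d dvd n. moebius_mu d * (c * A (n div d))) = c * (\<Sum>d | d dvd n. moebius_mu d * A (n div d))"
    by (simp add: sum_distrib_left mult_ac)
  thus "int n dvd (\<Sum>d | d dvd n. moebius_mu d * (c * A (n div d)))"
    using assms n unfolding dold_def by simp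
qed

text \<open>The only divisors of \<open>p\<close> are 1 and \<open>p\<close>. This instance of the
  Dold condition is all that (1) implies (2) needs.\<close>

lemma dold_prime:
  assumes "dold A" "prime p"
  shows "int p dvd A p - A 1"
proof -
  have "{d. d dvd p} = {1, p}" using assms by (auto simp: prime_nat_iff)
  moreover have "p \<noteq> 1" "p > 0" using assms prime_gt_0_nat by auto
  ultimately have "(\<Sum>d | d dvd p. moebius_mu d * A (p div d)) = A p - A 1"
    using assms by simp
  thus ?thesis using assms \<open>p > 0\<close> unfolding dold_def by metis
qed

section \<open>Logarithmic derivatives of integer power series\<close>

text \<open>Encodes $A = x F'/F$ without dividing.\<close>

definition fps_log_deriv :: "int fps \<Rightarrow> int fps \<Rightarrow> bool" where
  "fps_log_deriv F A \<longleftrightarrow> fps_nth F 0 = 1 \<and> fps_X * fps_deriv F = A * F"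

lemma fps_log_deriv_1: "fps_log_deriv 1 0"
  by (simp add: fps_log_deriv_def)

lemma fps_log_deriv_mult:
  assumes "fps_log_deriv F A" "fps_log_deriv G B"
  shows "fps_log_deriv (F * G) (A + B)"
proof -
  have "fps_X * fps_deriv (F * G) = (fps_X * fps_deriv F) * G + F * (fps_X * fps_deriv G)"
    by (simp add: algebra_simps)
  thus ?thesis using assms by (simp add: fps_log_deriv_def algebra_simps)
qed

lemma fps_log_deriv_inverse:
  assumes "fps_log_deriv F A" "F * G = 1"
  shows "fps_log_deriv G (-A)"
proof -
  have "fps_deriv (F * G) = 0" using assms by simp
  hence "fps_deriv F * G + F * fps_deriv G = 0" by (simp add: algebra_simps)
  hence "F * fps_deriv G = - (fps_deriv F * G)" by (simp add: eq_neg_iff_add_eq_0 add.commute)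
  \<comment> \<open>The product rule for \<open>F * G = 1\<close> has been multiplied by
    \<open>fps_X * G\<close>, so that \<open>F * G\<close> can be cancelled on the left and
    \<open>fps_X * fps_deriv F\<close> replaced by \<open>A * F\<close> on the right.\<close>
  hence "(F * G) * (fps_X * fps_deriv G) = - (fps_X * fps_deriv F) * G * G"
    by (metis (no_types, lifting) mult.assoc mult.commute mult_minus_left)
  hence "fps_X * fps_deriv G = - (A * (F * G)) * G"
    using assms unfolding fps_log_deriv_def by (simp add: mult_ac)
  hence "fps_X * fps_deriv G = - A * G" using assms by simp
  moreover have "fps_nth G 0 = 1"
    using arg_cong[OF assms(2), of "\<lambda>f. fps_nth f 0"] assms(1) by (simp add: fps_log_deriv_def)
  ultimately show ?thesis by (simp add: fps_log_deriv_def)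
qed

lemma fps_log_deriv_power:
  assumes "fps_log_deriv F A"
  shows "fps_log_deriv (F ^ n) (of_nat n * A)"
proof (induction n)
  case 0
  show ?case by (simp add: fps_log_deriv_1)
next
  case (Suc n)
  show ?case using fps_log_deriv_mult[OF assms Suc] by (simp add: algebra_simps)
qed

text \<open>The witness is (1 - x^d)^(-b): a power of the geometric series \<open>H\<close> if b
  \<ge> 0 and of the polynomial \<open>G\<close> otherwise, so coefficients stay integral for either
  sign of \<open>b\<close>.\<close>

lemma fps_log_deriv_geometric:
  fixes b :: int
  assumes "d > 0"
  shows "\<exists>F. fps_log_deriv F (Abs_fps (\<lambda>n. if n > 0 \<and> d dvd n then int d * b else 0))"
proof -
  define G where "G = (1 - fps_X ^ d :: int fps)"
  define H where "H = Abs_fps (\<lambda>n. if d dvd n then 1 else 0 :: int)"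
  define A where "A = of_nat d * (H - 1)"
  have GH: "G * H = 1"
  proof (rule fps_ext)
    fix n
    have "(d dvd n - d) = (d dvd n)" if "d \<le> n" using that by (simp add: dvd_minus_self)
    thus "fps_nth (G * H) n = fps_nth 1 n"
      using assms by (auto simp: G_def H_def algebra_simps fps_X_power_mult_nth dest: dvd_imp_le)
  qed
  have "fps_X * fps_deriv G = - of_nat d * fps_X ^ d"
    by (rule fps_ext) (use assms in \<open>auto simp: G_def fps_X_power_iff simp flip: fps_of_nat\<close>)
  moreover have "- A * G = of_nat d * (G - G * H)" by (simp add: A_def algebra_simps)
  ultimately have G: "fps_log_deriv G (- A)"
    using assms GH by (simp add: fps_log_deriv_def) (simp add: G_def algebra_simps)
  have H: "fps_log_deriv H A" using fps_log_deriv_inverse[OF G GH] by simp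
  have eq: "Abs_fps (\<lambda>n. if n > 0 \<and> d dvd n then int d * b else 0) = of_int b * A"
    by (rule fps_ext) (auto simp: A_def H_def fps_of_int[symmetric] fps_of_nat[symmetric])
  show ?thesis
  proof (cases "b \<ge> 0")
    case True
    thus ?thesis using fps_log_deriv_power[OF H, of "nat b"] unfolding eq by (auto simp: of_nat_nat)
  next
    case False
    hence "of_nat (nat (- b)) * (- A) = of_int b * A" by (simp add: of_nat_nat)
    thus ?thesis using fps_log_deriv_power[OF G, of "nat (- b)"] unfolding eq by auto
  qed
qed

text \<open>The series is the product of (1 - x^d)^(-b_d) over 1 \<le> d \<le> N; logarithmic
  derivatives of the factors add up.\<close>

lemma fps_log_deriv_product:
  fixes b :: "nat \<Rightarrow> int"
  shows "\<exists>F B. fps_log_deriv F B \<and>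
    (\<forall>n>0. fps_nth B n = (\<Sum>d | d \<le> N \<and> d dvd n. int d * b d))"
proof (induction N)
  case 0
  have "{d. d \<le> 0 \<and> d dvd n} = {}" if "n > 0" for n :: nat using that by auto
  hence "\<forall>n>0. fps_nth 0 n = (\<Sum>d | d \<le> 0 \<and> d dvd n. int d * b d)" by auto
  thus ?case using fps_log_deriv_1 by blast
next
  case (Suc N)
  then obtain F B where F: "fps_log_deriv F B"
    and B: "\<forall>n>0. fps_nth B n = (\<Sum>d | d \<le> N \<and> d dvd n. int d * b d)" by blast
  obtain G where G: "fps_log_deriv G (Abs_fps (\<lambda>n. if n > 0 \<and> Suc N dvd n then int (Suc N) * b (Suc N) else 0))"
    using fps_log_deriv_geometric[of "Suc N"] by blast
  have "{d. d \<le> Suc N \<and> d dvd n} =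
      (if Suc N dvd n then insert (Suc N) {d. d \<le> N \<and> d dvd n} else {d. d \<le> N \<and> d dvd n})" for n
    by (auto simp: le_Suc_eq)
  with B fps_log_deriv_mult[OF F G] show ?case
    by (intro exI conjI) (assumption, auto)
qed

text \<open>Newton's identities: compare coefficients of x^n in x F' = A F. The term k = 0 drops out
  because A has constant term 0.\<close>

lemma fps_log_deriv_nth:
  assumes "fps_log_deriv F A"
  shows "of_nat n * fps_nth F n = (\<Sum>k=1..n. fps_nth A k * fps_nth F (n - k))"
proof -
  have F: "fps_nth F 0 = 1" and *: "fps_X * fps_deriv F = A * F" using assms by (auto simp: fps_log_deriv_def)
  have "fps_nth A 0 = 0" using arg_cong[OF *, of "\<lambda>f. fps_nth f 0"] F by simp
  moreover have "of_nat n * fps_nth F n = (\<Sum>k=0..n. fps_nth A k * fps_nth F (n - k))"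
    using arg_cong[OF *, of "\<lambda>f. fps_nth f n"] by (cases n) (simp_all add: fps_mult_nth[of A])
  ultimately show ?thesis by (simp add: sum.atLeast_Suc_atMost)
qed

text \<open>By Newton's identities \<open>F\<close> and \<open>G\<close> agree below degree
  \<open>n\<close>, so in the identity for \<open>n\<close> every term except k = n cancels. The
  factor \<open>of_nat n\<close> is what makes the next exponent b_n an integer.\<close>

lemma fps_log_deriv_nth_diff:
  assumes "fps_log_deriv F A" "fps_log_deriv G B"
    and "\<And>k. 0 < k \<Longrightarrow> k < n \<Longrightarrow> fps_nth A k = fps_nth B k" and "n > 0"
  shows "fps_nth A n - fps_nth B n = of_nat n * (fps_nth F n - fps_nth G n)"
proof -
  have F0: "fps_nth F 0 = 1" "fps_nth G 0 = 1" using assms by (auto simp: fps_log_deriv_def)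
  have eq: "fps_nth F m = fps_nth G m" if "m < n" for m using that
  proof (induction m rule: less_induct)
    case (less m)
    show ?case
    proof (cases "m = 0")
      case False
      have "of_nat m * fps_nth F m = of_nat m * fps_nth G m"
        unfolding fps_log_deriv_nth[OF assms(1)] fps_log_deriv_nth[OF assms(2)]
        using less assms(3) by (intro sum.cong) auto
      thus ?thesis using False by simp
    qed (simp add: F0)
  qed
  obtain m where m: "n = Suc m" using assms(4) by (cases n) auto
  have "(\<Sum>k=1..m. fps_nth A k * fps_nth F (n - k)) = (\<Sum>k=1..m. fps_nth B k * fps_nth G (n - k))"
    using assms(3) eq m by (intro sum.cong) auto
  thus ?thesis
    using fps_log_deriv_nth[OF assms(1), of n] fps_log_deriv_nth[OF assms(2), of n] m F0
    by (simp add: algebra_simps)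
qed

text \<open>Factoring $F = \prod_d (1 - x^d)^{-b_d}$ up to degree $N$ and comparing logarithmic derivatives
  expresses $A$ as a divisor sum with integer $b_d$.\<close>

lemma fps_log_deriv_divisor_sum:
  assumes "fps_log_deriv F A"
  shows "\<exists>b :: nat \<Rightarrow> int. \<forall>n. 0 < n \<and> n \<le> N \<longrightarrow> fps_nth A n = (\<Sum>d | d dvd n. int d * b d)"
proof (induction N)
  case (Suc N)
  then obtain b :: "nat \<Rightarrow> int"
    where b: "\<And>n. 0 < n \<Longrightarrow> n \<le> N \<Longrightarrow> fps_nth A n = (\<Sum>d | d dvd n. int d * b d)" by blast
  obtain G B where G: "fps_log_deriv G B"
    and B: "\<And>n. n > 0 \<Longrightarrow> fps_nth B n = (\<Sum>d | d \<le> N \<and> d dvd n. int d * b d)"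
    using fps_log_deriv_product by blast
  \<comment> \<open>The new exponent is the defect of \<open>A\<close> against \<open>B\<close> in
    degree \<open>Suc N\<close> divided by \<open>Suc N\<close>; the values at
    \<open>n \<le> N\<close> are not disturbed, since \<open>Suc N\<close> divides no such positive
    \<open>n\<close>.\<close>
  define b' where "b' = b(Suc N := fps_nth F (Suc N) - fps_nth G (Suc N))"
  have small: "{d. d \<le> N \<and> d dvd n} = {d. d dvd n}" if "0 < n" "n \<le> N" for n
    using that by (auto dest: dvd_imp_le)
  have "fps_nth A (Suc N) - fps_nth B (Suc N) = int (Suc N) * b' (Suc N)"
    unfolding b'_def using fps_log_deriv_nth_diff[OF assms G, of "Suc N"] by (simp add: b B small)
  moreover have "{d. d dvd Suc N} = insert (Suc N) {d. d \<le> N \<and> d dvd Suc N}"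
    using dvd_imp_le[of _ "Suc N"] by (auto simp: le_Suc_eq)
  ultimately have "fps_nth A (Suc N) = (\<Sum>d | d dvd Suc N. int d * b' d)"
    by (auto simp: B b'_def intro!: sum.cong)
  moreover have "fps_nth A n = (\<Sum>d | d dvd n. int d * b' d)" if "0 < n" "n \<le> N" for n
    unfolding b[OF that] using that by (intro sum.cong) (auto simp: b'_def dest: dvd_imp_le)
  ultimately show ?case by (metis le_Suc_eq)
qed auto

lemma fps_log_deriv_imp_dold:
  assumes "fps_log_deriv F A"
  shows "dold (fps_nth A)"
  unfolding dold_def
proof (intro allI impI)
  fix n :: nat assume n: "n > 0"
  obtain b :: "nat \<Rightarrow> int" where "\<forall>m. 0 < m \<and> m \<le> n \<longrightarrow> fps_nth A m = (\<Sum>d | d dvd m. int d * b d)"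
    using fps_log_deriv_divisor_sum[OF assms] by blast
  hence "\<And>m. m dvd n \<Longrightarrow> fps_nth A m = (\<Sum>d | d dvd m. int d * b d)"
    using n by (auto dest: dvd_imp_le dvd_pos_nat)
  from moebius_inversion[OF n this]
  show "int n dvd (\<Sum>d | d dvd n. moebius_mu d * fps_nth A (n div d))" by simp
qed

lemma dold_cong:
  assumes "\<And>n. n > 0 \<Longrightarrow> A n = B n"
  shows "dold A \<longleftrightarrow> dold B"
proof -
  have "A (n div d) = B (n div d)" if "n > 0" "d dvd n" for n d
    using that assms by (metis dvd_div_eq_0_iff not_gr0)
  hence "(\<Sum>d | d dvd n. moebius_mu d * A (n div d)) = (\<Sum>d | d dvd n. moebius_mu d * B (n div d))"
    if "n > 0" for n
    using that by (intro sum.cong) auto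
  thus ?thesis by (simp add: dold_def)
qed

section \<open>Power sums of the two roots\<close>

fun lucas_companion :: "int \<Rightarrow> int \<Rightarrow> nat \<Rightarrow> int" where
  "lucas_companion r1 r2 0 = 2"
| "lucas_companion r1 r2 (Suc 0) = r1"
| "lucas_companion r1 r2 (Suc (Suc n)) =
    r1 * lucas_companion r1 r2 (Suc n) + r2 * lucas_companion r1 r2 n"

text \<open>These power sums of the roots are minus the logarithmic derivative of $1 - r_1 x - r_2 x^2$.\<close>

lemma dold_lucas_companion: "dold (lucas_companion r1 r2)"
proof -
  let ?V = "lucas_companion r1 r2"
  define F :: "int fps" where "F = 1 - fps_const r1 * fps_X - fps_const r2 * fps_X\<^sup>2"
  \<comment> \<open>The value at 0 must be 0, not -2, because x F' has no constant term.\<close>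
  define A where "A = Abs_fps (\<lambda>n. if n = 0 then 0 else - ?V n)"
  have V2: "?V 2 = r1 * r1 + r2 * 2" by (simp add: numeral_2_eq_2)
  have "fps_X * fps_deriv F = A * F"
  proof (rule fps_ext)
    fix n
    have L: "fps_X * fps_deriv F = - fps_const r1 * fps_X - fps_const (2 * r2) * fps_X\<^sup>2"
      by (simp add: F_def fps_deriv_power power2_eq_square algebra_simps fps_const_mult[symmetric]
          numeral_fps_const del: fps_const_mult)
    have R: "A * F = A - fps_const r1 * (fps_X * A) - fps_const r2 * (fps_X ^ 2 * A)"
      by (simp add: F_def algebra_simps)
    \<comment> \<open>Since \<open>A\<close> is 0 rather than -2 at 0, its coefficients obey the
      recurrence only from n = 3 on; degree 2 is checked with \<open>V2\<close>.\<close>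
    consider "n = 0" | "n = 1" | "n = 2" | m :: nat where "n = m + 3"
      by (metis One_nat_def Suc_1 add.commute add_Suc_right numeral_3_eq_3 add_0_right old.nat.exhaust)
    thus "fps_nth (fps_X * fps_deriv F) n = fps_nth (A * F) n"
    proof cases
      case (4 m)
      thus ?thesis unfolding L R
        by (simp add: A_def fps_X_power_mult_nth numeral_3_eq_3 algebra_simps)
    qed (unfold L R, insert V2,
        simp_all add: A_def fps_X_power_mult_nth fps_X_power_nth)
  qed
  moreover have "fps_nth F 0 = 1" by (simp add: F_def)
  ultimately have "dold (fps_nth A)" by (intro fps_log_deriv_imp_dold) (auto simp: fps_log_deriv_def)
  hence "dold (\<lambda>n. - 1 * fps_nth A n)" by (rule dold_mult)
  thus ?thesis by (subst dold_cong[where B = "\<lambda>n. - 1 * fps_nth A n"]) (auto simp: A_def)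
qed

section \<open>Nonresidues of non-squares\<close>

lemma Legendre_eqI:
  fixes p :: nat
  assumes "p > 2" "[Legendre a p = x] (mod int p)" "x \<in> {-1, 0, 1}"
  shows "Legendre a p = x"
proof (rule ccontr)
  assume "Legendre a p \<noteq> x"
  moreover have "int p dvd Legendre a p - x" using assms(2) by (simp add: cong_iff_dvd_diff)
  \<comment> \<open>Values in {-1, 0, 1} differ by at most 2 < p, so congruent ones are
    equal.\<close>
  ultimately have "int p \<le> \<bar>Legendre a p - x\<bar>" using dvd_imp_le_int[of "Legendre a p - x" "int p"] by auto
  moreover have "\<bar>Legendre a p - x\<bar> \<le> 2" using assms(3) by (auto simp: Legendre_def)
  ultimately show False using assms(1) by simp
qed

lemma Legendre_mult:
  fixes p :: nat
  assumes "prime p" "p > 2"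
  shows "Legendre (a * b) p = Legendre a p * Legendre b p"
proof (rule Legendre_eqI)
  have "[Legendre (a * b) p = a ^ ((p - 1) div 2) * b ^ ((p - 1) div 2)] (mod int p)"
    using euler_criterion[OF assms, of "a * b"] by (simp add: power_mult_distrib)
  moreover have "[Legendre a p * Legendre b p = a ^ ((p - 1) div 2) * b ^ ((p - 1) div 2)] (mod int p)"
    by (intro cong_mult euler_criterion assms)
  ultimately show "[Legendre (a * b) p = Legendre a p * Legendre b p] (mod int p)"
    using cong_sym cong_trans by blast
qed (auto simp: assms Legendre_def)

lemma Legendre_cong: "[a = b] (mod p) \<Longrightarrow> Legendre a p = Legendre b p"
  by (auto simp: Legendre_def QuadRes_def cong_def)

lemma Legendre_eq_0_iff: "Legendre a p = 0 \<longleftrightarrow> p dvd a"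
  by (simp add: Legendre_def cong_0_iff)

lemma Legendre_1: "p > 2 \<Longrightarrow> Legendre 1 (int p) = 1"
  using QuadRes_def[of "int p" 1] cong_refl[of "1 :: int"]
  by (auto simp: Legendre_def cong_0_iff intro!: exI[of _ 1])

lemma Legendre_square:
  assumes "\<not> p dvd a"
  shows "(Legendre a p)\<^sup>2 = 1"
  using assms by (auto simp: Legendre_def cong_0_iff)

lemma Legendre_minus_1:
  fixes p :: nat
  assumes "prime p" "p > 2"
  shows "Legendre (- 1) p = (- 1) ^ ((p - 1) div 2)"
  using assms euler_criterion[OF assms, of "-1"]
  by (intro Legendre_eqI) (auto simp: minus_one_power_iff)

lemma Legendre_power:
  fixes p :: nat
  assumes "prime p" "p > 2"
  shows "Legendre (a ^ n) p = Legendre a p ^ n"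
  using assms by (induction n) (auto simp: Legendre_mult Legendre_1)

text \<open>Gauss's lemma with p = 2h + 1: the doubles 2x for 1 \<le> x \<le> h are already reduced,
  and those exceeding h come from x > h div 2. The parity of h - h div 2 depends only on p mod
  8.\<close>

lemma Legendre_2:
  fixes p :: nat
  assumes "prime p" "p > 2"
  shows "Legendre 2 p = (if p mod 8 \<in> {1, 7} then 1 else - 1)"
proof -
  interpret GAUSS p 2
    using assms by unfold_locales (auto simp: cong_0_iff dest: zdvd_imp_le)
  define h where "h = (int p - 1) div 2"
  have p: "int p = 2 * h + 1" and "h > 0" using p_eq2 assms by (auto simp: h_def)
  have "C = (\<lambda>x. 2 * x) ` {0<..h}"
    unfolding C_def B_def A_def h_def[symmetric] image_image
    by (rule image_cong) (auto simp: p)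
  hence "E = (\<lambda>x. 2 * x) ` {h div 2<..h}"
    unfolding E_def h_def[symmetric] using \<open>h > 0\<close> by auto
  hence "card E = nat (h - h div 2)"
    by (simp add: card_image inj_on_def)
  moreover have "even (nat (h - h div 2)) \<longleftrightarrow> p mod 8 \<in> {1, 7}"
  proof -
    have "even (nat (h - h div 2)) \<longleftrightarrow> even (h - h div 2)"
      using \<open>h > 0\<close> by (simp add: even_nat_iff)
    also have "\<dots> \<longleftrightarrow> int p mod 8 \<in> {1, 7}" unfolding p by simp presburger
    also have "int p mod 8 = int (p mod 8)" by (simp add: zmod_int)
    also have "int (p mod 8) \<in> {1, 7} \<longleftrightarrow> p mod 8 \<in> {1, 7}" by auto
    finally show ?thesis .
  qed
  ultimately show ?thesis using gauss_lemma by (auto simp: minus_one_power_iff)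
qed

text \<open>With the sign $(-1)^{(q-1)/2}$ attached to $q$, reciprocity becomes multiplicative in $p$.\<close>

lemma Legendre_reciprocity_signed:
  fixes p q :: nat
  assumes "prime p" "p > 2" "prime q" "q > 2"
  shows "Legendre ((- 1) ^ ((q - 1) div 2) * int q) p = Legendre p q"
proof (cases "p = q")
  case True
  thus ?thesis by (simp add: Legendre_def cong_0_iff)
next
  case False
  let ?h = "(p - 1) div 2 * ((q - 1) div 2)"
  have "\<not> p dvd q" using assms False primes_dvd_imp_eq by blast
  hence sq: "Legendre q p * Legendre q p = 1"
    using Legendre_square[of "int p" "int q"] by (simp add: power2_eq_square)
  have "Legendre ((- 1) ^ ((q - 1) div 2) * int q) p = (- 1) ^ ?h * Legendre q p"
    using assms by (simp add: Legendre_mult Legendre_power Legendre_minus_1 power_mult)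
  also have "(- 1) ^ ?h = Legendre p q * Legendre q p"
    using Quadratic_Reciprocity[of p q] assms False by simp
  finally show ?thesis using sq by simp
qed

text \<open>Otherwise squaring would be surjective, hence injective, on the finite set of residues;
  but 1 and -1 have the same square and differ since q > 2.\<close>

lemma Legendre_nonresidue_exists:
  fixes q :: nat
  assumes "prime q" "q > 2"
  shows "\<exists>a. Legendre a q = - 1"
proof (rule ccontr)
  assume *: "\<nexists>a. Legendre a q = - 1"
  let ?S = "{0..<int q}" and ?f = "\<lambda>x. x\<^sup>2 mod int q"
  have "?S \<subseteq> ?f ` ?S"
  proof
    fix a assume a: "a \<in> ?S"
    have "\<exists>y. [y\<^sup>2 = a] (mod int q)"
    proof (cases "[a = 0] (mod int q)")
      case True
      hence "[0\<^sup>2 = a] (mod int q)" by (simp add: cong_sym)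
      thus ?thesis by blast
    next
      case False
      thus ?thesis using * by (auto simp: Legendre_def QuadRes_def split: if_splits)
    qed
    then obtain y where "[y\<^sup>2 = a] (mod int q)" by blast
    hence "a = ?f (y mod int q)" using a by (simp add: cong_def power_mod)
    thus "a \<in> ?f ` ?S" using assms by auto
  qed
  moreover have "?f ` ?S \<subseteq> ?S" using assms by auto
  ultimately have "inj_on ?f ?S" by (intro finite_surj_inj) auto
  moreover have "?f (int q - 1) = ?f 1"
  proof -
    have "(int q - 1)\<^sup>2 = 1 + int q * (int q - 2)" by (simp add: power2_eq_square algebra_simps)
    thus ?thesis by simp
  qed
  ultimately have "int q - 1 = 1" by (rule inj_onD) (use assms in auto)
  thus False using assms by simp
qed

section \<open>Jacobi symbols\<close>

definition jacobi :: "int \<Rightarrow> nat \<Rightarrow> int" where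
  "jacobi a n = (\<Prod>p\<in>#prime_factorization n. Legendre a (int p))"

lemma odd_prime_factor_gt_2:
  assumes "prime p" "p dvd n" "odd (n :: nat)"
  shows "p > 2"
  using assms by (metis dvd_trans prime_ge_2_nat order_le_imp_less_or_eq)

lemma jacobi_mult_left:
  assumes "odd n"
  shows "jacobi (a * b) n = jacobi a n * jacobi b n"
proof -
  have "jacobi (a * b) n = (\<Prod>p\<in>#prime_factorization n. Legendre a (int p) * Legendre b (int p))"
    unfolding jacobi_def using assms odd_prime_factor_gt_2[of _ n]
    by (intro arg_cong[where f = prod_mset] image_mset_cong Legendre_mult) auto
  thus ?thesis by (simp add: jacobi_def prod_mset.distrib)
qed

text \<open>Induction over the prime factors of \<open>n\<close> carries a formula for Legendre
  symbols at odd primes over to Jacobi symbols, once the formula is multiplicative on odd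
  numbers.\<close>

lemma jacobi_eq_character:
  fixes \<chi> :: "nat \<Rightarrow> int"
  assumes "\<chi> 1 = 1"
    and "\<And>p n. prime p \<Longrightarrow> odd p \<Longrightarrow> odd n \<Longrightarrow> \<chi> (p * n) = \<chi> p * \<chi> n"
    and "\<And>p. prime p \<Longrightarrow> p > 2 \<Longrightarrow> Legendre a (int p) = \<chi> p"
    and "odd n"
  shows "jacobi a n = \<chi> n"
  using assms(4)
proof (induction n rule: prime_divisors_induct)
  case (unit x)
  thus ?case using assms(1) by (simp add: jacobi_def)
next
  case (factor p x)
  hence "odd p" "odd x" by auto
  moreover have "x \<noteq> 0" using \<open>odd x\<close> by (metis even_zero)
  moreover have "p > 2" using factor odd_prime_factor_gt_2[of p p] \<open>odd p\<close> by auto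
  ultimately show ?case
    using factor assms(2,3) by (simp add: jacobi_def prime_factorization_times_prime)
qed simp

lemma jacobi_minus_1:
  assumes "odd n"
  shows "jacobi (- 1) n = (if n mod 4 = 1 then 1 else - 1)"
proof (rule jacobi_eq_character)
  fix p n :: nat assume "odd p" "odd n"
  hence "p mod 4 \<in> {1, 3}" "n mod 4 \<in> {1, 3}" by simp_all presburger+
  thus "(if p * n mod 4 = 1 then 1 else - 1) =
      (if p mod 4 = 1 then 1 else - 1) * (if n mod 4 = 1 then 1 else - 1 :: int)"
    by (subst mod_mult_eq[symmetric]) auto
next
  fix p :: nat assume p: "prime p" "p > 2"
  hence "odd p" using prime_odd_nat by blast
  hence "even ((p - 1) div 2) \<longleftrightarrow> p mod 4 = 1" by presburger
  thus "Legendre (- 1) (int p) = (if p mod 4 = 1 then 1 else - 1)"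
    using p by (simp add: Legendre_minus_1 minus_one_power_iff)
qed (use assms in auto)

lemma jacobi_2:
  assumes "odd n"
  shows "jacobi 2 n = (if n mod 8 \<in> {1, 7} then 1 else - 1)"
proof (rule jacobi_eq_character)
  fix p n :: nat assume "odd p" "odd n"
  hence "p mod 8 \<in> {1, 3, 5, 7}" "n mod 8 \<in> {1, 3, 5, 7}" by simp_all presburger+
  thus "(if p * n mod 8 \<in> {1, 7} then 1 else - 1) =
      (if p mod 8 \<in> {1, 7} then 1 else - 1) * (if n mod 8 \<in> {1, 7} then 1 else - 1 :: int)"
    by (subst mod_mult_eq[symmetric]) auto
next
  fix p :: nat assume p: "prime p" "p > 2"
  thus "Legendre 2 (int p) = (if p mod 8 \<in> {1, 7} then 1 else - 1)"
    by (rule Legendre_2)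
qed (use assms in auto)

lemma jacobi_1_left:
  assumes "odd n"
  shows "jacobi 1 n = 1"
  using assms by (intro jacobi_eq_character[where \<chi> = "\<lambda>_. 1"]) (auto simp: Legendre_1)

lemma jacobi_odd_prime:
  assumes "prime q" "q > 2" "n mod 4 = 1"
  shows "jacobi (int q) n = Legendre (int n) (int q)"
proof -
  have n: "odd n" using assms(3) by presburger
  have *: "jacobi ((- 1) ^ k) n = 1" for k
  proof (induction k)
    case (Suc k)
    thus ?case using jacobi_mult_left[OF n, of "- 1" "(- 1) ^ k"] assms(3) n
      by (simp add: jacobi_minus_1)
  qed (use n in \<open>simp add: jacobi_1_left\<close>)
  have "jacobi ((- 1) ^ ((q - 1) div 2) * int q) n = Legendre (int n) (int q)"
  proof (rule jacobi_eq_character)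
    show "Legendre ((- 1) ^ ((q - 1) div 2) * int q) (int p) = Legendre (int p) (int q)"
      if "prime p" "p > 2" for p
      using that assms by (intro Legendre_reciprocity_signed)
  qed (use assms n in \<open>auto simp: Legendre_1 Legendre_mult\<close>)
  thus ?thesis using n * by (simp add: jacobi_mult_left)
qed

text \<open>Induction over the prime factors of \<open>a\<close>: n = 1 mod 8 settles units and the
  prime 2, while reciprocity turns an odd prime \<open>q\<close> into the symbol of n = 1 mod
  q.\<close>

lemma jacobi_eq_1:
  assumes "a \<noteq> 0" "[int n = 1] (mod 8 * a)"
  shows "jacobi a n = 1"
  using assms
proof (induction a rule: prime_divisors_induct)
  case (unit a)
  have "[int n = 1] (mod 8)" using unit.prems(2) by (rule cong_dvd_modulus) simp
  hence n: "n mod 8 = 1" by (simp add: cong_def) presburger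
  hence "n mod 4 = 1" "odd n" by presburger+
  moreover have "a = 1 \<or> a = -1" using unit.hyps by auto
  ultimately show ?case by (auto simp: jacobi_1_left jacobi_minus_1)
next
  case (factor p a)
  have "[int n = 1] (mod 8)" using factor.prems(2) by (rule cong_dvd_modulus) simp
  hence n: "n mod 8 = 1" by (simp add: cong_def) presburger
  hence n4: "n mod 4 = 1" "odd n" by presburger+
  have "[int n = 1] (mod 8 * a)" using factor.prems(2) by (rule cong_dvd_modulus) simp
  hence "jacobi a n = 1" using factor by auto
  moreover have "jacobi p n = 1"
  proof (cases "p = 2")
    case True
    thus ?thesis using n n4 by (simp add: jacobi_2)
  next
    case False
    define q where "q = nat p"
    have p: "p = int q" "q > 2" using factor.hyps False prime_ge_2_int[of p] by (auto simp: q_def)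
    moreover have "prime q" using factor.hyps p by simp
    ultimately have p: "p = int q" "prime q" "q > 2" by auto
    have "[int n = 1] (mod int q)"
      using factor.prems(2) by (rule cong_dvd_modulus) (simp add: p)
    hence "Legendre (int n) (int q) = 1" using Legendre_cong Legendre_1 p by metis
    thus ?thesis using p n4 by (simp add: jacobi_odd_prime)
  qed
  ultimately show ?case using n4 by (simp add: jacobi_mult_left)
qed simp

section \<open>Moduli with Jacobi symbol -1\<close>

lemma chinese_remainder_nat_of_int:
  fixes m k :: int
  assumes "coprime m k" "m \<noteq> 0" "k \<noteq> 0"
  shows "\<exists>n :: nat. [int n = u] (mod m) \<and> [int n = v] (mod k)"
proof -
  obtain x where x: "[x = u] (mod m)" "[x = v] (mod k)"
    using binary_chinese_remainder_int[OF assms(1)] by blast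
  \<comment> \<open>Reducing modulo the absolute value gives a nonnegative remainder, so
    \<open>nat\<close> loses nothing.\<close>
  let ?n = "nat (x mod \<bar>m * k\<bar>)"
  have n: "[int ?n = x] (mod \<bar>m * k\<bar>)" using assms by (simp add: cong_def)
  have "[int ?n = x] (mod m)" "[int ?n = x] (mod k)"
    by (rule cong_dvd_modulus[OF n]; simp)+
  thus ?thesis using x cong_trans by blast
qed

text \<open>Take \<open>n\<close> to be a nonresidue mod \<open>q\<close> and 1 modulo the part
  \<open>K\<close> of \<open>8 * t * M\<close> prime to \<open>q\<close>. Then \<open>q\<close>
  contributes -1 and \<open>t\<close> contributes 1.\<close>

lemma jacobi_minus_1_exists_odd_prime:
  fixes t M :: int and q :: nat
  assumes q: "prime q" "q > 2" and t: "\<not> int q dvd t" and "M \<noteq> 0"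
  shows "\<exists>n. odd n \<and> coprime (int n) M \<and> jacobi (int q * t) n = - 1"
proof -
  have "t \<noteq> 0" using t by auto
  have pq: "prime (int q)" using q by simp
  obtain j K where K: "8 * t * M = int q ^ j * K" "\<not> int q dvd K"
    using multiplicity_decompose'[of "8 * t * M" "int q"] \<open>t \<noteq> 0\<close> \<open>M \<noteq> 0\<close> pq
    by (metis mult_eq_0_iff not_prime_unit zero_neq_numeral)
  have "K \<noteq> 0" using K by auto
  obtain a where a: "Legendre a q = - 1" using Legendre_nonresidue_exists q by blast
  have "coprime (int q) K" using pq K by (simp add: prime_imp_coprime)
  then obtain n where n: "[int n = a] (mod int q)" "[int n = 1] (mod K)"
    using chinese_remainder_nat_of_int \<open>K \<noteq> 0\<close> q by (metis not_prime_0 of_nat_eq_0_iff)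
  have "\<not> int q dvd 8"
  proof
    assume "int q dvd 8"
    hence "int q dvd 2 ^ 3" by simp
    hence "int q dvd 2" using pq prime_dvd_power by blast
    thus False using q by (auto dest: zdvd_imp_le)
  qed
  \<comment> \<open>Being prime to \<open>q\<close>, the number \<open>8 * t\<close> must divide
    \<open>K\<close>, so the congruence mod \<open>K\<close> controls the symbol of
    \<open>t\<close>.\<close>
  hence "coprime (int q) (8 * t)" using pq t by (simp add: prime_imp_coprime prime_dvd_mult_iff)
  hence "coprime (8 * t) (int q ^ j)" by (simp add: coprime_commute)
  moreover have "8 * t dvd int q ^ j * K" unfolding K(1)[symmetric] by simp
  ultimately have "8 * t dvd K" by (simp add: coprime_dvd_mult_right_iff)
  hence nt: "[int n = 1] (mod 8 * t)" using n(2) cong_dvd_modulus by blast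
  hence "[int n = 1] (mod 8)" by (rule cong_dvd_modulus) simp
  hence "n mod 8 = 1" by (simp add: cong_def) presburger
  hence n4: "n mod 4 = 1" "odd n" by presburger+
  have L: "Legendre (int n) (int q) = - 1" using n a Legendre_cong by metis
  have "jacobi (int q * t) n = - 1"
    using L n4 q nt \<open>t \<noteq> 0\<close> by (simp add: jacobi_mult_left jacobi_odd_prime jacobi_eq_1)
  moreover have "coprime (int n) M"
  proof -
    have "\<not> int q dvd int n" using L Legendre_eq_0_iff[of "int n" "int q"] by auto
    hence "coprime (int n) (int q ^ j)" using pq prime_imp_coprime[of "int q" "int n"]
      by (simp add: coprime_commute)
    moreover have "coprime (int n) K" using n(2) cong_imp_coprime[of 1 "int n" K] by (simp add: cong_sym)
    ultimately have "coprime (int n) (8 * t * M)" unfolding K(1) by simp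
    thus ?thesis by simp
  qed
  ultimately show ?thesis using n4 by blast
qed

text \<open>Without an odd prime factor, a squarefree \<open>s\<close> other than 1 is -1, 2 or -2,
  and then the class of \<open>n\<close> mod 8 decides.\<close>

lemma jacobi_minus_1_exists:
  fixes s M :: int
  assumes "squarefree s" "s \<noteq> 1" "M \<noteq> 0"
  shows "\<exists>n. odd n \<and> coprime (int n) M \<and> jacobi s n = - 1"
proof (cases "\<exists>q::nat. prime q \<and> q > 2 \<and> int q dvd s")
  case True
  then obtain q t where q: "prime q" "q > 2" and t: "s = int q * t" by (auto elim: dvdE)
  have "\<not> int q dvd t"
  proof
    assume "int q dvd t"
    hence "(int q)\<^sup>2 dvd s" unfolding t by (simp add: power2_eq_square)
    hence "is_unit (int q)" using assms by (auto simp: squarefree_def)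
    thus False using q by simp
  qed
  thus ?thesis using jacobi_minus_1_exists_odd_prime q assms t by blast
next
  case False
  have no_odd: "\<not> p dvd s" if "prime p" "p \<noteq> 2" for p :: int
  proof -
    define q where "q = nat p"
    have q: "p = int q" "q > 2" using that prime_ge_2_int[of p] by (auto simp: q_def)
    moreover have "prime q" using that q by simp
    ultimately show ?thesis using False by blast
  qed
  have unit: "u = 1 \<or> u = - 1" if u: "u dvd s" "odd u" for u
  proof (rule ccontr)
    assume "\<not> ?thesis"
    hence "\<not> is_unit u" by auto
    moreover have "u \<noteq> 0" using u by auto
    ultimately obtain p where "prime p" "p dvd u" using prime_divisorE by blast
    with u no_odd[of p] show False using dvd_trans by blast
  qed
  have s: "s = - 1 \<or> s = 2 \<or> s = - 2"
  proof (cases "even s")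
    case True
    then obtain u where u: "s = 2 * u" by auto
    have "odd u"
    proof
      assume "even u"
      hence "2\<^sup>2 dvd s" using u by (auto simp: power2_eq_square)
      hence "is_unit (2 :: int)" using assms(1) unfolding squarefree_def by blast
      thus False by simp
    qed
    thus ?thesis using unit[of u] u by auto
  next
    case False
    thus ?thesis using unit[of s] assms by auto
  qed
  \<comment> \<open>The symbol of -1 is -1 at 3 mod 8. At 5 mod 8 the symbol of -1 is 1 and that of
    2 is -1, which serves both 2 and -2.\<close>
  define r :: int where "r = (if s = - 1 then 3 else 5)"
  obtain j K where K: "M = 2 ^ j * K" "odd K"
    using multiplicity_decompose'[of M "2 :: int"] \<open>M \<noteq> 0\<close> by (metis odd_one)
  have "coprime (2 ^ 3) K" using K by (intro coprime_power_left_iff[THEN iffD2]) simp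
  then obtain n where n: "[int n = r] (mod 8)" "[int n = 1] (mod K)"
    using chinese_remainder_nat_of_int[of 8 K r 1] K by fastforce
  have n8: "n mod 8 = (if s = - 1 then 3 else 5)"
    using n(1) by (cases "s = - 1") (simp_all add: cong_def r_def, presburger+)
  have "odd n" using n8 by (cases "s = - 1") (simp_all, presburger+)
  have n4: "n mod 4 = (if s = - 1 then 3 else 1)"
    using n8 by (cases "s = - 1") (simp_all, presburger+)
  have "coprime (int n) (2 ^ j)" using \<open>odd n\<close> by simp
  moreover have "coprime (int n) K" using n(2) cong_imp_coprime[of 1 "int n" K] by (simp add: cong_sym)
  ultimately have "coprime (int n) M" unfolding K(1) by simp
  moreover have "jacobi s n = - 1"
    using s
  proof (elim disjE)
    assume "s = - 2"
    thus ?thesis using jacobi_mult_left[of n "- 1" 2] \<open>odd n\<close> n4 n8 by (simp add: jacobi_2 jacobi_minus_1)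
  qed (use \<open>odd n\<close> n4 n8 in \<open>simp_all add: jacobi_2 jacobi_minus_1\<close>)
  ultimately show ?thesis using \<open>odd n\<close> by blast
qed

text \<open>A Jacobi symbol -1 for the squarefree part of \<open>D\<close> forces a Legendre symbol
  other than 1 at some prime factor of \<open>n\<close>; coprimality to \<open>N * D\<close>
  excludes 0. Letting \<open>N\<close> vary yields infinitely many such primes.\<close>

lemma nonsquare_nonresidue_prime_exists:
  fixes D N :: int
  assumes "\<nexists>k. D = k\<^sup>2" "N \<noteq> 0"
  shows "\<exists>p::nat. prime p \<and> p > 2 \<and> \<not> int p dvd N \<and> Legendre D (int p) = - 1"
proof -
  define s k where "s = squarefree_part D" and "k = square_part D"
  have D: "D = s * k\<^sup>2" unfolding s_def k_def by (rule squarefree_decompose)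
  have "D \<noteq> 0" "s \<noteq> 1" using assms(1) D by auto
  obtain n where n: "odd n" "coprime (int n) (N * D)" "jacobi s n = - 1"
    using jacobi_minus_1_exists[of s "N * D"] \<open>s \<noteq> 1\<close> \<open>D \<noteq> 0\<close> assms by (auto simp: s_def)
  have "\<exists>p\<in>#prime_factorization n. Legendre s (int p) \<noteq> 1"
  proof (rule ccontr)
    assume "\<not> ?thesis"
    hence "image_mset (\<lambda>p. Legendre s (int p)) (prime_factorization n) =
        image_mset (\<lambda>p. 1) (prime_factorization n)" by (intro image_mset_cong) auto
    hence "jacobi s n = 1" unfolding jacobi_def by simp
    thus False using n by simp
  qed
  then obtain p where p: "prime p" "p dvd n" "Legendre s (int p) \<noteq> 1" by auto
  have "p > 2" using p n odd_prime_factor_gt_2 by blast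
  have "\<not> int p dvd N * D"
  proof
    assume "int p dvd N * D"
    moreover have "int p dvd int n" using p by simp
    ultimately have "is_unit (int p)" using n(2) coprime_common_divisor by blast
    thus False using p by simp
  qed
  hence nd: "\<not> int p dvd N" "\<not> int p dvd s" "\<not> int p dvd k"
    unfolding D by (auto simp: power2_eq_square)
  have "Legendre s (int p) = - 1" using p(3) nd(2) by (auto simp: Legendre_def cong_0_iff split: if_splits)
  hence "Legendre D (int p) = - 1"
    unfolding D using p \<open>p > 2\<close> nd Legendre_square[of "int p" k]
    by (simp add: Legendre_mult Legendre_power)
  thus ?thesis using p \<open>p > 2\<close> nd by blast
qed

section \<open>Binary recurrences modulo primes\<close>

lemma fermat_int:
  fixes p :: nat and a :: int
  assumes "prime p" "p > 2"
  shows "[a ^ p = a] (mod int p)"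
proof (cases "int p dvd a")
  case True
  hence "int p dvd a ^ p" using assms by (intro dvd_trans[OF _ dvd_power]) auto
  thus ?thesis using True by (simp add: cong_iff_dvd_diff)
next
  case False
  have "odd p" using assms prime_odd_nat by blast
  hence p: "p = Suc (2 * ((p - 1) div 2))" by presburger
  have "[a * (a ^ ((p - 1) div 2))\<^sup>2 = a * (Legendre a p)\<^sup>2] (mod int p)"
    by (intro cong_mult cong_pow cong_refl cong_sym[OF euler_criterion] assms)
  moreover have "a * (a ^ ((p - 1) div 2))\<^sup>2 = a ^ p"
    by (subst (2) p) (simp add: power_mult[symmetric] mult.commute)
  ultimately show ?thesis using Legendre_square[OF False] by simp
qed

text \<open>The integers $u$, $v$ do not depend on the choice of the square root of $D$.\<close>

lemma frobenius_quadratic: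
  fixes r D :: int and p :: nat
  assumes "prime p" "p > 2"
  shows "\<exists>u v :: int. \<forall>d :: complex. d\<^sup>2 = of_int D \<longrightarrow>
    (of_int r + d) ^ p = of_int (r ^ p + int p * u) + of_int (D ^ ((p - 1) div 2) + int p * v) * d"
proof -
  \<comment> \<open>These split powers of \<open>d\<close> by parity: d^m = e m + f m * d.\<close>
  define e f where "e m = (if even m then D ^ (m div 2) else 0)"
    and "f m = (if odd m then D ^ (m div 2) else 0)" for m :: nat
  \<comment> \<open>The division by \<open>p\<close> is exact for 0 < k < p, the only range in which
    \<open>c\<close> is used.\<close>
  define c where "c k = int ((p choose k) div p) * r ^ k" for k
  define u v where "u = (\<Sum>k=1..<p. c k * e (p - k))" and "v = (\<Sum>k=1..<p. c k * f (p - k))"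
  have "odd p" using assms prime_odd_nat by blast
  have "(of_int r + d) ^ p = of_int (r ^ p + int p * u) + of_int (D ^ ((p - 1) div 2) + int p * v) * d"
    if d: "d\<^sup>2 = of_int D" for d :: complex
  proof -
    have dm: "d ^ m = of_int (e m) + of_int (f m) * d" for m
    proof (cases "even m")
      case True
      then obtain i where "m = 2 * i" by auto
      thus ?thesis by (simp add: e_def f_def power_mult d)
    next
      case False
      then obtain i where "m = 2 * i + 1" by (rule oddE)
      thus ?thesis by (simp add: e_def f_def power_mult d power_Suc2 del: power_Suc)
    qed
    have mid: "of_nat (p choose k) * of_int r ^ k * d ^ (p - k) =
        of_nat p * (of_int (c k * e (p - k)) + of_int (c k * f (p - k)) * d)" if "k \<in> {1..<p}" for k
    proof -
      have "p dvd p choose k" using that assms by (intro dvd_choose_prime) auto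
      then obtain t where t: "p choose k = p * t" by auto
      have "p > 0" using assms by simp
      thus ?thesis by (simp add: t c_def dm algebra_simps)
    qed
    have "{..p} = insert 0 (insert p {1..<p})" using assms by auto
    hence "(of_int r + d) ^ p = d ^ p + of_int r ^ p +
        (\<Sum>k=1..<p. of_nat (p choose k) * of_int r ^ k * d ^ (p - k))"
      using assms by (simp add: binomial_ring add.assoc)
    also have "(\<Sum>k=1..<p. of_nat (p choose k) * of_int r ^ k * d ^ (p - k)) =
        of_nat p * (of_int u + of_int v * d)"
      by (simp only: sum.cong[OF refl mid] u_def v_def of_int_sum sum_distrib_right
          sum_distrib_left[symmetric] sum.distrib)
    also have "d ^ p = of_int (D ^ ((p - 1) div 2)) * d"
    proof -
      have "p div 2 = (p - 1) div 2" using \<open>odd p\<close> by presburger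
      thus ?thesis using \<open>odd p\<close> by (subst dm) (simp add: e_def f_def)
    qed
    finally show ?thesis by (simp add: algebra_simps)
  qed
  thus ?thesis by blast
qed

text \<open>Doubling the roots gives r1 + d and r1 - d with d = \<alpha> - \<beta>, whose p-th
  powers share the same integers \<open>X\<close> and \<open>Y\<close>. Hence 2^p U_p is an integer
  combination of \<open>X\<close> and \<open>Y\<close>, to be reduced by Fermat and Euler.\<close>

lemma recurrence_mod_prime:
  fixes r1 D :: int and U :: "nat \<Rightarrow> int" and \<alpha> \<beta> l1 l2 :: complex
  assumes p: "prime p" "p > 2"
    and sum: "\<alpha> + \<beta> = of_int r1" and diff: "(\<alpha> - \<beta>)\<^sup>2 = of_int D"
    and U: "\<And>n. of_int (U n) = l1 * \<alpha> ^ n + l2 * \<beta> ^ n"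
  shows "[2 * U p = U 0 * r1 + (2 * U 1 - r1 * U 0) * Legendre D p] (mod int p)"
proof -
  define e where "e = 2 * U 1 - r1 * U 0"
  let ?\<delta> = "\<alpha> - \<beta>" and ?h = "(p - 1) div 2"
  have U0: "of_int (U 0) = l1 + l2" using U[of 0] by simp
  have e: "of_int e = (l1 - l2) * ?\<delta>"
    using U[of 1] by (simp add: e_def U0 sum[symmetric] algebra_simps)
  obtain u v :: int where uv: "\<And>d :: complex. d\<^sup>2 = of_int D \<Longrightarrow>
    (of_int r1 + d) ^ p = of_int (r1 ^ p + int p * u) + of_int (D ^ ?h + int p * v) * d"
    using frobenius_quadratic[OF p, of D r1] by blast
  define X Y where "X = r1 ^ p + int p * u" and "Y = D ^ ?h + int p * v"
  have a: "2 * \<alpha> = of_int r1 + ?\<delta>" and b: "2 * \<beta> = of_int r1 + (- ?\<delta>)"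
    by (simp_all add: sum[symmetric])
  have A: "(2 * \<alpha>) ^ p = of_int X + of_int Y * ?\<delta>"
    unfolding a X_def Y_def by (rule uv[OF diff])
  have B: "(2 * \<beta>) ^ p = of_int X + of_int Y * (- ?\<delta>)"
    unfolding b X_def Y_def by (rule uv) (simp only: power2_minus diff)
  have "of_int (2 ^ p * U p) = l1 * (2 * \<alpha>) ^ p + l2 * (2 * \<beta>) ^ p"
    by (simp add: U power_mult_distrib algebra_simps)
  also have "\<dots> = (l1 + l2) * of_int X + ((l1 - l2) * ?\<delta>) * of_int Y"
    unfolding A B by (simp add: algebra_simps)
  also have "\<dots> = of_int (U 0 * X + e * Y)" by (simp only: U0[symmetric] e[symmetric] of_int_add of_int_mult)
  finally have eq: "2 ^ p * U p = U 0 * X + e * Y" by (simp only: of_int_eq_iff)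
  have "[2 * U p = 2 ^ p * U p] (mod int p)"
    by (intro cong_mult cong_refl cong_sym[OF fermat_int] p)
  moreover have "[U 0 * X + e * Y = U 0 * r1 + e * Legendre D p] (mod int p)"
  proof (intro cong_add cong_mult cong_refl)
    have "[X = r1 ^ p] (mod int p)" by (simp add: X_def cong_iff_dvd_diff)
    thus "[X = r1] (mod int p)" using fermat_int[OF p] cong_trans by blast
    have "[Y = D ^ ?h] (mod int p)" by (simp add: Y_def cong_iff_dvd_diff)
    thus "[Y = Legendre D p] (mod int p)" using cong_sym[OF euler_criterion[OF p]] cong_trans by blast
  qed
  ultimately show ?thesis unfolding eq e_def using cong_trans by blast
qed

section \<open>Equivalence of the three conditions\<close>

theorem theorem1:
  fixes r1 r2 \<Delta> :: int and U :: "nat \<Rightarrow> int" and \<alpha> \<beta> l1 l2 :: complex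
  assumes rec: "\<And>n. n \<ge> 2 \<Longrightarrow> U n = r1 * U (n - 1) + r2 * U (n - 2)"
    and roots: "{x. poly [:- of_int r2, - of_int r1, 1:] x = 0} = {\<alpha>, \<beta>}"
    and distinct: "\<alpha> \<noteq> \<beta>"
    and Delta: "\<Delta> = r1\<^sup>2 + 4 * r2"
    and nonsquare: "\<not> (\<exists>k::int. \<Delta> = k\<^sup>2)"
    and closed_form: "\<And>n. of_int (U n) = l1 * \<alpha> ^ n + l2 * \<beta> ^ n"
  shows "(almost_dold U \<longleftrightarrow> l1 = l2) \<and>
         (l1 = l2 \<longleftrightarrow> dold (\<lambda>n. 2 * r2 * rad \<Delta> * U n))"
proof -
  have diff: "(\<alpha> - \<beta>)\<^sup>2 = of_int \<Delta>"
    unfolding Delta by (rule discriminant_eq_root_difference_square[OF roots distinct])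
  have a: "\<alpha> * \<alpha> = of_int r1 * \<alpha> + of_int r2" and b: "\<beta> * \<beta> = of_int r1 * \<beta> + of_int r2"
    using roots by (auto simp: set_eq_iff algebra_simps)
  have "(\<alpha> - \<beta>) * (\<alpha> + \<beta>) = (\<alpha> - \<beta>) * of_int r1"
    using a b by (simp add: algebra_simps)
  hence sum: "\<alpha> + \<beta> = of_int r1" using distinct by simp
  define e where "e = 2 * U 1 - r1 * U 0"
  have "of_int e = (l1 - l2) * (\<alpha> - \<beta>)"
    using closed_form[of 0] closed_form[of 1] by (simp add: e_def sum[symmetric] algebra_simps)
  hence e0: "l1 = l2" if "e = 0" using that distinct by simp

  have 12: "l1 = l2" if almost: "almost_dold U"
  proof (rule e0, rule ccontr)
    assume "e \<noteq> 0"
    obtain c :: nat where c: "c > 0" "dold (\<lambda>n. int c * U n)" using almost by (auto simp: almost_dold_def)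
    obtain p :: nat where p: "prime p" "p > 2" "\<not> int p dvd 2 * int c * e" "Legendre \<Delta> p = - 1"
      using nonsquare_nonresidue_prime_exists[OF nonsquare, of "2 * int c * e"] c \<open>e \<noteq> 0\<close> by auto
    have "[2 * U p = U 0 * r1 - e] (mod int p)"
      using recurrence_mod_prime[OF p(1,2) sum diff closed_form] p(4) by (simp add: e_def)
    hence "int p dvd 2 * U p - (U 0 * r1 - e)" by (simp add: cong_iff_dvd_diff)
    hence "int p dvd int c * (2 * U p - (U 0 * r1 - e))" by simp
    \<comment> \<open>Subtracting twice the Dold congruence at \<open>p\<close> eliminates
      \<open>U p\<close>; since 2 U_1 = r1 U_0 + e, what remains is 2ce.\<close>
    moreover have "int p dvd 2 * (int c * U p - int c * U 1)"
      using dold_prime[OF c(2) p(1)] by (rule dvd_mult)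
    ultimately have "int p dvd int c * (2 * U p - (U 0 * r1 - e)) - 2 * (int c * U p - int c * U 1)"
      by (rule dvd_diff)
    moreover have "int c * (2 * U p - (U 0 * r1 - e)) - 2 * (int c * U p - int c * U 1) = 2 * int c * e"
      by (simp add: e_def algebra_simps)
    ultimately show False using p(3) by simp
  qed

  have 23: "dold (\<lambda>n. 2 * r2 * rad \<Delta> * U n)" if "l1 = l2"
  proof -
    have V: "of_int (lucas_companion r1 r2 n) = \<alpha> ^ n + \<beta> ^ n" for n
    proof (induction n rule: induct_nat_012)
      case (ge2 n)
      have "\<alpha> ^ Suc (Suc n) = of_int r1 * \<alpha> ^ Suc n + of_int r2 * \<alpha> ^ n"
        if "\<alpha> * \<alpha> = of_int r1 * \<alpha> + of_int r2" for \<alpha> :: complex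
        using arg_cong[OF that, of "\<lambda>x. \<alpha> ^ n * x"] by (simp add: algebra_simps)
      from this[OF a] this[OF b] show ?case
        using ge2 by (simp only: lucas_companion.simps of_int_add of_int_mult) (simp add: algebra_simps)
    qed (use sum in simp_all)
    have "of_int (2 * U n) = (of_int (U 0 * lucas_companion r1 r2 n) :: complex)" for n
      using that closed_form[of 0] by (simp add: closed_form V algebra_simps)
    hence "2 * U n = U 0 * lucas_companion r1 r2 n" for n by (simp only: of_int_eq_iff)
    \<comment> \<open>The factor 2 absorbs the denominator in U_n = (U_0 / 2) V_n.\<close>
    hence "(\<lambda>n. 2 * r2 * rad \<Delta> * U n) = (\<lambda>n. (r2 * rad \<Delta> * U 0) * lucas_companion r1 r2 n)"
      by (intro ext) (metis (no_types, lifting) mult.assoc mult.commute)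
    thus ?thesis using dold_mult[OF dold_lucas_companion] by simp
  qed

  have 31: "almost_dold U" if 3: "dold (\<lambda>n. 2 * r2 * rad \<Delta> * U n)"
  proof -
    define c where "c = 2 * r2 * rad \<Delta>"
    \<comment> \<open>With r2 = 0 the discriminant would be the square of r1.\<close>
    have "r2 \<noteq> 0" using nonsquare Delta by auto
    moreover have "rad \<Delta> \<noteq> 0" by (auto simp: rad_def)
    ultimately have "nat \<bar>c\<bar> > 0" by (simp add: c_def)
    \<comment> \<open>The multiplier \<open>c\<close> may be negative, whereas
      \<open>almost_dold\<close> asks for a positive one.\<close>
    moreover have "(\<lambda>n. int (nat \<bar>c\<bar>) * U n) = (\<lambda>n. sgn c * (c * U n))"
      by (auto simp: sgn_if abs_if)
    hence "dold (\<lambda>n. int (nat \<bar>c\<bar>) * U n)"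
      using dold_mult[OF 3, of "sgn c"] by (simp only: c_def)
    ultimately show ?thesis unfolding almost_dold_def by blast
  qed
  show ?thesis using 12 23 31 by blast
qed

end
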